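(* For each $n\in N$ let $\mathcal{D}_n$ be a coherent set of desirable gambles on $\mathcal{X}_n$, and let $\otimes_{n\in N}\mathcal{D}_n$ be their independent natural extension. Consider the coherent lower previsions $\underline{P}_n$ on $\mathcal{G}(\mathcal{X}_n)$ given by $\underline{P}_n(f_n):=\sup\{\mu\in\mathbb{R}:f_n-\mu\in\mathcal{D}_n\}$ for all $f_n\in\mathcal{G}(\mathcal{X}_n)$. Then the independent natural extension $\underline{E}_N$ of the marginal lower previsions $\underline{P}_n$, $n\in N$, i.e. $$\underline{E}_N(f):=\sup_{\substack{h_n\in\mathcal{G}(\mathcal{X}_N)\\ n\in N}}\ \min_{z_N\in\mathcal{X}_N}\Big[f(z_N)-\sum_{n\in N}\big[h_n(z_N)-\underline{P}_n(h_n(\cdot,z_{N\setminus\{n\}}))\big]\Big],$$ satisfies $$\underline{E}_N(f)=\sup\{\mu\in\mathbb{R}:f-\mu\in\otimes_{n\in N}\mathcal{D}_n\}\quad\text{for all }f\in\mathcal{G}(\mathcal{X}_N).$$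
   Context: Let $N$ be a finite non-empty index set, and for each $n\in N$ let $\mathcal{X}_n$ be a finite non-empty set. For $R\subseteq N$ let $\mathcal{X}_R:=\prod_{r\in R}\mathcal{X}_r$, with $\mathcal{X}_\emptyset$ a one-point set. For $z_N\in\mathcal{X}_N$, $z_R$ is its restriction to the coordinates in $R$. For a finite non-empty set $\mathcal{Z}$, a gamble on $\mathcal{Z}$ is a function $\mathcal{Z}\to\mathbb{R}$; $\mathcal{G}(\mathcal{Z})$ is the linear space of all gambles on $\mathcal{Z}$; real numbers are identified with constant gambles. Write $f\geq g$ for pointwise inequality and $f>g$ if $f\geq g$ and $f\neq g$; $\mathcal{G}(\mathcal{Z})_{>0}:=\{f\in\mathcal{G}(\mathcal{Z}):f>0\}$. For $\mathcal{A}\subseteq\mathcal{G}(\mathcal{Z})$, $\mathrm{posi}(\mathcal{A}):=\{\sum_{k=1}^{m}\lambda_kf_k : m\geq 1,\ f_k\in\mathcal{A},\ \lambda_k>0\}$. A set of desirable gambles $\mathcal{D}\subseteq\mathcal{G}(\mathcal{Z})$ is coherent if (D1) $0\notin\mathcal{D}$; (D2) $\mathcal{G}(\mathcal{Z})_{>0}\subseteq\mathcal{D}$; (D3) $\mathrm{posi}(\mathcal{D})=\mathcal{D}$. For $R\subseteq N$, a gamble on $\mathcal{X}_R$ is identified with its cylindrical extension to $\mathcal{X}_N$; $\mathbb{I}_{\{x_R\}}$ denotes the indicator of $x_R\in\mathcal{X}_R$. For $h\in\mathcal{G}(\mathcal{X}_N)$, $h(\cdot,z_{N\setminus\{n\}})$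 is the gamble on $\mathcal{X}_n$ obtained by fixing the coordinates in $N\setminus\{n\}$ to $z_{N\setminus\{n\}}$. The independent natural extension of the coherent sets $\mathcal{D}_n$ is $$\otimes_{n\in N}\mathcal{D}_n:=\mathrm{posi}\Big(\mathcal{G}(\mathcal{X}_N)_{>0}\cup\bigcup_{n\in N}\mathcal{A}^{\mathrm{irr}}_{N\setminus\{n\}\to\{n\}}\Big),\quad \mathcal{A}^{\mathrm{irr}}_{N\setminus\{n\}\to\{n\}}:=\mathrm{posi}\left(\{\mathbb{I}_{\{x_{N\setminus\{n\}}\}}g : g\in\mathcal{D}_n,\ x_{N\setminus\{n\}}\in\mathcal{X}_{N\setminus\{n\}}\}\right).$$ *)

theory Defs
  imports "HOL-Analysis.Analysis"
begin

text \<open>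
  All possibility spaces are carrier sets. The joint space of the variables with indices in
  \<open>R\<close> is \<open>Pi\<^sub>E R X\<close>, so that \<open>Pi\<^sub>E {} X\<close> has exactly one point. A gamble on \<open>Z\<close> is a function that
  is \<^const>\<open>undefined\<close> outside \<open>Z\<close>; hence two gambles are equal iff they agree on \<open>Z\<close>, and
  the zero gamble, sums and differences are written \<open>\<lambda>z\<in>Z. \<dots>\<close>.
\<close>

definition gambles :: "'z set \<Rightarrow> ('z \<Rightarrow> real) set" where
  "gambles Z = (Z \<rightarrow>\<^sub>E (UNIV :: real set))"

definition pos_gambles :: "'z set \<Rightarrow> ('z \<Rightarrow> real) set" where
  "pos_gambles Z = {f \<in> gambles Z. (\<forall>z\<in>Z. 0 \<le> f z) \<and> f \<noteq> (\<lambda>z\<in>Z. 0)}"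

definition posi :: "'z set \<Rightarrow> ('z \<Rightarrow> real) set \<Rightarrow> ('z \<Rightarrow> real) set" where
  "posi Z A =
     {(\<lambda>z\<in>Z. \<Sum>k = 1..m. c k * f k z) | (m :: nat) (c :: nat \<Rightarrow> real) (f :: nat \<Rightarrow> 'z \<Rightarrow> real).
        1 \<le> m \<and> (\<forall>k\<in>{1..m}. f k \<in> A \<and> 0 < c k)}"

definition coherent_desirable :: "'z set \<Rightarrow> ('z \<Rightarrow> real) set \<Rightarrow> bool" where
  "coherent_desirable Z D \<longleftrightarrow>
     D \<subseteq> gambles Z \<and> (\<lambda>z\<in>Z. 0) \<notin> D \<and> pos_gambles Z \<subseteq> D \<and> posi Z D = D"

text \<open>
  The supremum is taken in the reals. For finite non-empty \<open>Z\<close>, coherent \<open>D\<close> and a gamble \<open>f\<close> on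
  \<open>Z\<close>, the set contains every number below the minimum of \<open>f\<close> and is bounded above by the maximum.
\<close>

definition lower_prevision :: "'z set \<Rightarrow> ('z \<Rightarrow> real) set \<Rightarrow> ('z \<Rightarrow> real) \<Rightarrow> real" where
  "lower_prevision Z D f = Sup {\<mu>. (\<lambda>z\<in>Z. f z - \<mu>) \<in> D}"

text \<open>
  The argument \<open>g\<close> is a gamble on \<open>X n\<close>; the product of the two cylindrical extensions is a gamble
  on \<open>Pi\<^sub>E N X\<close>.
\<close>

definition irr_gambles ::
  "'n set \<Rightarrow> ('n \<Rightarrow> 'x set) \<Rightarrow> 'n \<Rightarrow> ('x \<Rightarrow> real) set \<Rightarrow> (('n \<Rightarrow> 'x) \<Rightarrow> real) set" where
  "irr_gambles N X n D =
     posi (Pi\<^sub>E N X)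
       {(\<lambda>z\<in>Pi\<^sub>E N X. indicator {x} (restrict z (N - {n})) * g (z n)) | g x.
          g \<in> D \<and> x \<in> Pi\<^sub>E (N - {n}) X}"

definition indep_nat_ext ::
  "'n set \<Rightarrow> ('n \<Rightarrow> 'x set) \<Rightarrow> ('n \<Rightarrow> ('x \<Rightarrow> real) set) \<Rightarrow> (('n \<Rightarrow> 'x) \<Rightarrow> real) set" where
  "indep_nat_ext N X D =
     posi (Pi\<^sub>E N X) (pos_gambles (Pi\<^sub>E N X) \<union> (\<Union>n\<in>N. irr_gambles N X n (D n)))"

text \<open>
  The gamble \<open>h(\<cdot>, y)\<close> on \<open>X n\<close>, for a gamble \<open>h\<close> on \<open>Pi\<^sub>E N X\<close> and \<open>y \<in> Pi\<^sub>E (N - {n}) X\<close>.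
\<close>

definition fix_others ::
  "('n \<Rightarrow> 'x set) \<Rightarrow> 'n \<Rightarrow> (('n \<Rightarrow> 'x) \<Rightarrow> real) \<Rightarrow> ('n \<Rightarrow> 'x) \<Rightarrow> 'x \<Rightarrow> real" where
  "fix_others X n h y = (\<lambda>x\<in>X n. h (y(n := x)))"

definition indep_nat_ext_prevision ::
  "'n set \<Rightarrow> ('n \<Rightarrow> 'x set) \<Rightarrow> ('n \<Rightarrow> ('x \<Rightarrow> real) \<Rightarrow> real) \<Rightarrow> (('n \<Rightarrow> 'x) \<Rightarrow> real) \<Rightarrow> real" where
  "indep_nat_ext_prevision N X P f =
     (SUP h \<in> N \<rightarrow>\<^sub>E gambles (Pi\<^sub>E N X).
        MIN z \<in> Pi\<^sub>E N X.
          f z - (\<Sum>n\<in>N. h n z - P n (fix_others X n (h n) (restrict z (N - {n})))))"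

end

theory Submission
  imports Defs
begin

text \<open>
  Every element of the independent natural extension dominates a sum \<open>\<Sum>n\<in>N. h n\<close> in which each
  \<open>h n (\<cdot>, y)\<close> is zero or desirable for \<open>n\<close>; its local lower prevision is then non-negative, which
  gives one inequality. Conversely \<open>h n (\<cdot>, y) - P n (h n (\<cdot>, y)) + \<eta>\<close> is desirable for every
  \<open>\<eta> > 0\<close>, so that the bracketed minimum for \<open>h\<close> is, up to a multiple of \<open>\<eta>\<close>, an acceptable buying
  price for \<open>f\<close>. Suprema in the reals need boundedness, i.e. that the extension avoids sure loss:
  each marginal is dominated by a linear functional with non-negative weights, and the product of
  these weights makes the expectation of every \<open>h n\<close> non-negative.
\<close>

section \<open>Positive hulls\<close>

lemma posi_subset_gambles: "posi Z A \<subseteq> gambles Z"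
  by (auto simp: posi_def gambles_def)

lemma posiE:
  assumes "f \<in> posi Z A"
  obtains m :: nat and c :: "nat \<Rightarrow> real" and u where "f = (\<lambda>z\<in>Z. \<Sum>k = 1..m. c k * u k z)" "1 \<le> m"
    "\<forall>k\<in>{1..m}. u k \<in> A \<and> 0 < c k"
  using assms unfolding posi_def by blast

lemma posi_add:
  assumes "f \<in> posi Z A" "g \<in> posi Z A"
  shows "(\<lambda>z\<in>Z. f z + g z) \<in> posi Z A"
proof -
  obtain m :: nat and c u where f: "f = (\<lambda>z\<in>Z. \<Sum>k = 1..m. c k * u k z)" "1 \<le> m"
      "\<forall>k\<in>{1..m}. u k \<in> A \<and> 0 < c k"
    using assms(1) by (rule posiE)
  obtain m' :: nat and c' u' where g: "g = (\<lambda>z\<in>Z. \<Sum>k = 1..m'. c' k * u' k z)" "1 \<le> m'"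
      "\<forall>k\<in>{1..m'}. u' k \<in> A \<and> 0 < c' k"
    using assms(2) by (rule posiE)
  \<comment> \<open>The two combinations are concatenated: the terms of \<open>g\<close> follow
    those of \<open>f\<close>, with their index shifted by \<open>m\<close>.\<close>
  define d where "d k = (if k \<le> m then c k else c' (k - m))" for k
  define v where "v k = (if k \<le> m then u k else u' (k - m))" for k
  have "(\<Sum>k = 1..m + m'. d k * v k z) = (\<Sum>k = 1..m. c k * u k z) + (\<Sum>k = 1..m'. c' k * u' k z)"
    for z
  proof -
    have "(\<Sum>k = m + 1..m + m'. d k * v k z) = (\<Sum>k = 1..m'. c' k * u' k z)"
      by (rule sum.reindex_bij_witness[where i = "\<lambda>k. k + m" and j = "\<lambda>k. k - m"])
        (auto simp: d_def v_def)
    moreover have "(\<Sum>k = 1..m. d k * v k z) = (\<Sum>k = 1..m. c k * u k z)"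
      by (rule sum.cong) (auto simp: d_def v_def)
    ultimately show ?thesis
      using sum.ub_add_nat[of 1 m "\<lambda>k. d k * v k z" m'] by simp
  qed
  then have "(\<lambda>z\<in>Z. f z + g z) = (\<lambda>z\<in>Z. \<Sum>k = 1..m + m'. d k * v k z)"
    by (auto simp: f(1) g(1))
  moreover have "\<forall>k\<in>{1..m + m'}. v k \<in> A \<and> 0 < d k"
  proof
    fix k assume "k \<in> {1..m + m'}"
    then have "k \<in> {1..m} \<or> \<not> k \<le> m \<and> k - m \<in> {1..m'}" by auto
    then show "v k \<in> A \<and> 0 < d k"
      using f(3) g(3) by (auto simp: d_def v_def)
  qed
  ultimately show ?thesis
    using f(2) unfolding posi_def
    by (intro CollectI exI[of _ "m + m'"] exI[of _ d] exI[of _ v]) auto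
qed

lemma posi_scale:
  assumes "f \<in> posi Z A" "0 < a"
  shows "(\<lambda>z\<in>Z. a * f z) \<in> posi Z A"
proof -
  obtain m :: nat and c u where f: "f = (\<lambda>z\<in>Z. \<Sum>k = 1..m. c k * u k z)" "1 \<le> m"
      "\<forall>k\<in>{1..m}. u k \<in> A \<and> 0 < c k"
    using assms(1) by (rule posiE)
  have "(\<lambda>z\<in>Z. a * f z) = (\<lambda>z\<in>Z. \<Sum>k = 1..m. (a * c k) * u k z)"
    by (auto simp: f(1) sum_distrib_left mult.assoc)
  then show ?thesis
    using f(2,3) assms(2) unfolding posi_def
    by (intro CollectI exI[of _ m] exI[of _ "\<lambda>k. a * c k"] exI[of _ u]) auto
qed

lemma posi_superset:
  assumes "f \<in> A" "f \<in> gambles Z"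
  shows "f \<in> posi Z A"
proof -
  have "f = (\<lambda>z\<in>Z. \<Sum>k = 1..1::nat. 1 * f z)"
    using assms(2) by (auto simp: gambles_def PiE_def extensional_def)
  then show ?thesis
    using assms(1) unfolding posi_def
    by (intro CollectI exI[of _ "1::nat"] exI[of _ "\<lambda>_. 1"] exI[of _ "\<lambda>_. f"]) auto
qed

text \<open>Since a combination has at least one term, induction on its length can start from a
  scaled generator; \<open>K\<close> need not hold for the zero gamble. This carries properties from
  generators to whole hulls.\<close>

lemma posi_induct [consumes 1, case_names base add scale]:
  assumes "e \<in> posi Z A"
    and base: "\<And>f. f \<in> A \<Longrightarrow> K f"
    and add: "\<And>f g. K f \<Longrightarrow> K g \<Longrightarrow> K (\<lambda>z\<in>Z. f z + g z)"
    and scale: "\<And>a f. 0 < a \<Longrightarrow> K f \<Longrightarrow> K (\<lambda>z\<in>Z. a * f z)"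
  shows "K e"
proof -
  obtain m :: nat and c u where e: "e = (\<lambda>z\<in>Z. \<Sum>k = 1..m. c k * u k z)" "1 \<le> m"
      "\<forall>k\<in>{1..m}. u k \<in> A \<and> 0 < c k"
    using assms(1) by (rule posiE)
  have "K (\<lambda>z\<in>Z. \<Sum>k = 1..m. c k * u k z)"
    using e(2,3)
  proof (induction m rule: dec_induct)
    case base
    then show ?case using scale[of "c 1" "u 1"] assms(2) by (simp add: restrict_def)
  next
    case (step m)
    have "K (\<lambda>z\<in>Z. (\<lambda>z\<in>Z. \<Sum>k = 1..m. c k * u k z) z + (\<lambda>z\<in>Z. c (Suc m) * u (Suc m) z) z)"
    proof (rule add)
      show "K (\<lambda>z\<in>Z. \<Sum>k = 1..m. c k * u k z)"
        by (rule step.IH) (use step.prems in auto)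
      show "K (\<lambda>z\<in>Z. c (Suc m) * u (Suc m) z)"
        using step.prems by (intro scale assms(2)) auto
    qed
    also have "(\<lambda>z\<in>Z. (\<lambda>z\<in>Z. \<Sum>k = 1..m. c k * u k z) z + (\<lambda>z\<in>Z. c (Suc m) * u (Suc m) z) z)
        = (\<lambda>z\<in>Z. \<Sum>k = 1..Suc m. c k * u k z)"
      by auto
    finally show ?case .
  qed
  then show ?thesis by (simp add: e(1))
qed

section \<open>Cones of gambles that avoid sure loss, and their lower previsions\<close>

text \<open>Coherence is relaxed: instead of excluding the zero gamble, the cone only excludes
  gambles that are negative everywhere. Adjoining both \<open>F - a\<close> and its negative may
  bring zero into the cone, so (D1) would not survive the extension steps below, whereas this
  condition does.\<close>

locale sure_loss_free_cone =
  fixes Z :: "'z set" and C :: "('z \<Rightarrow> real) set"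
  assumes finite: "finite Z" and nonempty: "Z \<noteq> {}"
    and subset_gambles: "C \<subseteq> gambles Z"
    and add: "f \<in> C \<Longrightarrow> g \<in> C \<Longrightarrow> (\<lambda>z\<in>Z. f z + g z) \<in> C"
    and scale: "0 < a \<Longrightarrow> f \<in> C \<Longrightarrow> (\<lambda>z\<in>Z. a * f z) \<in> C"
    and pos: "pos_gambles Z \<subseteq> C"
    and no_sure_loss: "g \<in> C \<Longrightarrow> \<exists>z\<in>Z. 0 \<le> g z"
begin

lemma restrict_mem: "g \<in> C \<Longrightarrow> restrict g Z = g"
  using subset_gambles by (auto simp: gambles_def PiE_def extensional_restrict)

lemma mono:
  assumes "g \<in> C" and "\<And>z. z \<in> Z \<Longrightarrow> g z \<le> f z"
  shows "restrict f Z \<in> C"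
proof (cases "(\<lambda>z\<in>Z. f z - g z) = (\<lambda>z\<in>Z. 0)")
  case True
  then have "restrict f Z = restrict g Z"
    by (metis (mono_tags, lifting) eq_iff_diff_eq_0 restrict_apply' restrict_ext)
  then show ?thesis using assms(1) restrict_mem by simp
next
  case False
  then have "(\<lambda>z\<in>Z. f z - g z) \<in> C"
    using pos assms(2) by (auto simp: pos_gambles_def gambles_def)
  from add[OF this assms(1)] show ?thesis
    by (simp add: restrict_def cong: if_cong)
qed

lemma strictly_positive_mem:
  assumes "\<And>z. z \<in> Z \<Longrightarrow> 0 < f z"
  shows "restrict f Z \<in> C"
proof -
  obtain z where "z \<in> Z" using nonempty by auto
  then have "restrict f Z \<noteq> (\<lambda>z\<in>Z. 0)"
    using assms by (metis less_irrefl restrict_apply')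
  then show ?thesis
    using assms pos by (force simp: pos_gambles_def gambles_def)
qed

text \<open>The summand \<open>e\<close> keeps the case of an empty \<open>I\<close> inside the
  cone, which may lack the zero gamble.\<close>

lemma add_sum_mem:
  assumes "finite I" "e \<in> C" and "\<And>i. i \<in> I \<Longrightarrow> (\<lambda>z\<in>Z. f i z) \<in> C"
  shows "(\<lambda>z\<in>Z. e z + (\<Sum>i\<in>I. f i z)) \<in> C"
  using assms(1,3)
proof (induction I)
  case empty
  then show ?case using assms(2) restrict_mem by simp
next
  case (insert i I)
  have "(\<lambda>z\<in>Z. (\<lambda>z\<in>Z. f i z) z + (\<lambda>z\<in>Z. e z + (\<Sum>i\<in>I. f i z)) z) \<in> C"
    by (rule add[OF insert.prems[OF insertI1] insert.IH[OF insert.prems[OF insertI2]]])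
  also have "(\<lambda>z\<in>Z. (\<lambda>z\<in>Z. f i z) z + (\<lambda>z\<in>Z. e z + (\<Sum>i\<in>I. f i z)) z)
      = (\<lambda>z\<in>Z. e z + (\<Sum>i\<in>insert i I. f i z))"
    using insert.hyps by (auto simp: algebra_simps)
  finally show ?case .
qed

text \<open>Together with the next lemma this makes the real \<open>Sup\<close> in
  \<open>lower_prevision\<close> a genuine supremum. A price of \<open>f\<close> cannot exceed
  \<open>f\<close> at a point where the difference is non-negative.\<close>

lemma bdd_above_buying_prices: "bdd_above {\<mu>. (\<lambda>z\<in>Z. f z - \<mu>) \<in> C}"
proof (rule bdd_aboveI)
  fix \<mu> assume "\<mu> \<in> {\<mu>. (\<lambda>z\<in>Z. f z - \<mu>) \<in> C}"
  then obtain z where "z \<in> Z" "\<mu> \<le> f z" using no_sure_loss by fastforce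
  then show "\<mu> \<le> Max (f ` Z)"
    using finite by (meson Max_ge finite_imageI imageI order_trans)
qed

lemma buying_prices_nonempty: "{\<mu>. (\<lambda>z\<in>Z. f z - \<mu>) \<in> C} \<noteq> {}"
proof -
  have "Min (f ` Z) - 1 < f z" if "z \<in> Z" for z
  proof -
    have "Min (f ` Z) \<le> f z" using finite that by simp
    then show ?thesis by linarith
  qed
  then have "(\<lambda>z\<in>Z. f z - (Min (f ` Z) - 1)) \<in> C"
    by (intro strictly_positive_mem) simp
  then show ?thesis by blast
qed

lemma le_lower_prevision:
  "(\<lambda>z\<in>Z. f z - \<mu>) \<in> C \<Longrightarrow> \<mu> \<le> lower_prevision Z C f"
  unfolding lower_prevision_def by (rule cSup_upper[OF _ bdd_above_buying_prices]) simp

lemma lower_prevision_le: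
  "(\<And>\<mu>. (\<lambda>z\<in>Z. f z - \<mu>) \<in> C \<Longrightarrow> \<mu> \<le> b) \<Longrightarrow> lower_prevision Z C f \<le> b"
  unfolding lower_prevision_def by (rule cSup_least[OF buying_prices_nonempty]) simp

text \<open>Acceptable prices are closed downwards by \<open>mono\<close>. Strictness matters, as
  the supremum need not be attained.\<close>

lemma less_lower_prevision_mem:
  assumes "\<mu> < lower_prevision Z C f"
  shows "(\<lambda>z\<in>Z. f z - \<mu>) \<in> C"
proof -
  obtain \<nu> where "(\<lambda>z\<in>Z. f z - \<nu>) \<in> C" "\<mu> < \<nu>"
    using less_cSupD[OF buying_prices_nonempty assms[unfolded lower_prevision_def]] by auto
  then show ?thesis
    by (rule_tac mono[of "\<lambda>z\<in>Z. f z - \<nu>"]) auto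
qed

lemma lower_prevision_nonneg:
  assumes "g \<in> C \<or> (\<forall>z\<in>Z. g z = 0)"
  shows "0 \<le> lower_prevision Z C g"
proof (rule dense_le)
  fix \<mu> :: real assume "\<mu> < 0"
  have "(\<lambda>z\<in>Z. g z - \<mu>) \<in> C"
  proof (cases "g \<in> C")
    case True
    then show ?thesis using \<open>\<mu> < 0\<close> by (rule_tac mono[of g]) auto
  next
    case False
    then show ?thesis using \<open>\<mu> < 0\<close> assms by (intro strictly_positive_mem) auto
  qed
  then show "\<mu> \<le> lower_prevision Z C g" by (rule le_lower_prevision)
qed

text \<open>
  One step of the Hahn-Banach construction: \<open>F\<close> and \<open>-F\<close> become marginally acceptable at the price
  \<^term>\<open>lower_prevision Z C F\<close>.
\<close>

lemma no_sure_loss_extension: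
  assumes "g \<in> C"
  shows "\<exists>z\<in>Z. 0 \<le> g z + l * (F z - lower_prevision Z C F)"
proof (rule ccontr)
  define a where "a = lower_prevision Z C F"
  \<comment> \<open>The margin of the supposed sure loss, positive because \<open>Z\<close> is
    finite.\<close>
  define d where "d = - Max ((\<lambda>z. g z + l * (F z - a)) ` Z)"
  assume "\<not> ?thesis"
  then have "0 < d"
    unfolding d_def a_def using finite nonempty by (subst neg_0_less_iff_less, subst Max_less_iff) auto
  have d: "g z + l * (F z - a) \<le> - d" if "z \<in> Z" for z
    unfolding d_def using finite that by simp
  consider "l = 0" | "l < 0" | "0 < l" by linarith
  then show False
  proof cases
    case 1
    then show False using no_sure_loss[OF assms] d \<open>0 < d\<close> by force
  next
    case 2
    define k where "k = - l"
    have "0 < k" using 2 by (simp add: k_def)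
    \<comment> \<open>Dividing the sure loss by \<open>k\<close> shows that
      \<open>F - (a + d / k)\<close> dominates \<open>g / k\<close>, so a price above the supremum
      \<open>a\<close> would be acceptable.\<close>
    have "(\<lambda>z\<in>Z. F z - (a + d / k)) \<in> C"
    proof (rule mono[OF scale[OF _ assms, of "1 / k"]])
      fix z assume "z \<in> Z"
      then have "g z + d \<le> k * (F z - a)" using d[of z] by (simp add: k_def)
      then have "(g z + d) / k \<le> F z - a"
        using \<open>0 < k\<close> by (simp add: divide_le_eq mult.commute)
      then show "(\<lambda>z\<in>Z. 1 / k * g z) z \<le> F z - (a + d / k)"
        using \<open>z \<in> Z\<close> by (simp add: add_divide_distrib)
    qed (use \<open>0 < k\<close> in simp)
    then have "a + d / k \<le> a" unfolding a_def by (rule le_lower_prevision)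
    then show False using \<open>0 < d\<close> \<open>0 < k\<close> by (simp add: field_simps)
  next
    case 3
    \<comment> \<open>The price \<open>a\<close> may not be acceptable, so a slightly lower one is
      used; after scaling by \<open>l\<close> this costs only half of the margin
      \<open>d\<close>.\<close>
    have "(\<lambda>z\<in>Z. F z - (a - d / (2 * l))) \<in> C"
      using 3 \<open>0 < d\<close> by (intro less_lower_prevision_mem) (simp add: a_def)
    from no_sure_loss[OF add[OF assms scale[OF 3 this]]]
    obtain z where "z \<in> Z" "0 \<le> g z + l * (F z - (a - d / (2 * l)))" by auto
    moreover have "l * (F z - (a - d / (2 * l))) = l * (F z - a) + d / 2"
      using 3 by (simp add: field_simps)
    ultimately show False using d[of z] \<open>0 < d\<close> by simp
  qed
qed

end

section \<open>Domination by non-negative linear functionals\<close>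

lemma sure_loss_free_cone_extension:
  assumes "sure_loss_free_cone Z C"
  shows "sure_loss_free_cone Z
    {(\<lambda>z\<in>Z. g z + l * (F z - lower_prevision Z C F)) | g l. g \<in> C}" (is "sure_loss_free_cone Z ?C")
proof -
  interpret sure_loss_free_cone Z C by fact
  define a where "a = lower_prevision Z C F"
  have C_I: "\<exists>g l. f = (\<lambda>z\<in>Z. g z + l * (F z - lower_prevision Z C F)) \<and> g \<in> C"
    if "f = (\<lambda>z\<in>Z. g z + l * (F z - lower_prevision Z C F))" "g \<in> C" for f g l
    using that by blast
  show ?thesis
  proof
    show "?C \<subseteq> gambles Z" by (auto simp: gambles_def)
    show "pos_gambles Z \<subseteq> ?C"
    proof
      fix f assume "f \<in> pos_gambles Z"
      then have "f \<in> C" using pos by auto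
      then show "f \<in> ?C"
        using restrict_mem[of f] by (intro CollectI C_I[of f f 0]) auto
    qed
    show "\<exists>z\<in>Z. 0 \<le> g z" if g: "g \<in> ?C" for g
      using g no_sure_loss_extension by fastforce
    show "(\<lambda>z\<in>Z. c * f z) \<in> ?C" if c: "0 < c" and f: "f \<in> ?C" for c f
    proof -
      obtain g l where gl: "f = (\<lambda>z\<in>Z. g z + l * (F z - lower_prevision Z C F))" "g \<in> C"
        using f by blast
      show ?thesis
        by (intro CollectI C_I[OF _ scale[OF c gl(2)], of _ "c * l"])
          (auto simp: gl(1) algebra_simps)
    qed
    show "(\<lambda>z\<in>Z. f z + f' z) \<in> ?C" if f: "f \<in> ?C" "f' \<in> ?C" for f f'
    proof -
      obtain g l where gl: "f = (\<lambda>z\<in>Z. g z + l * (F z - lower_prevision Z C F))" "g \<in> C"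
        using f(1) by blast
      obtain g' l' where gl': "f' = (\<lambda>z\<in>Z. g' z + l' * (F z - lower_prevision Z C F))" "g' \<in> C"
        using f(2) by blast
      show ?thesis
        by (intro CollectI C_I[OF _ add[OF gl(2) gl'(2)], of _ "l + l'"])
          (auto simp: gl(1) gl'(1) algebra_simps)
    qed
  qed (use finite nonempty in auto)
qed

text \<open>The gambles \<open>F i\<close> are priced one after another: the induction hypothesis is
  applied to the cone already enlarged by the first of them, hence the generalisation over
  \<open>C\<close>. The prices \<open>p\<close> are uniform in \<open>g\<close> and
  \<open>l\<close>.\<close>

lemma simultaneous_extension:
  assumes "finite I" "sure_loss_free_cone Z C"
  shows "\<exists>p :: 'i \<Rightarrow> real. \<forall>g\<in>C. \<forall>l. \<exists>z\<in>Z. 0 \<le> g z + (\<Sum>i\<in>I. l i * (F i z - p i))"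
  using assms
proof (induction I arbitrary: C)
  case empty
  then show ?case by (auto dest: sure_loss_free_cone.no_sure_loss)
next
  case (insert i I)
  define a where "a = lower_prevision Z C (F i)"
  define C' where "C' = {(\<lambda>z\<in>Z. g z + l * (F i z - a)) | g l. g \<in> C}"
  have "sure_loss_free_cone Z C'"
    unfolding C'_def a_def by (rule sure_loss_free_cone_extension) fact
  from insert.IH[OF this] obtain p :: "'i \<Rightarrow> real" where
    p: "\<And>g l. g \<in> C' \<Longrightarrow> \<exists>z\<in>Z. 0 \<le> g z + (\<Sum>i\<in>I. l i * (F i z - p i))"
    by blast
  have "\<exists>z\<in>Z. 0 \<le> g z + (\<Sum>j\<in>insert i I. l j * (F j z - (p(i := a)) j))" if "g \<in> C" for g l
  proof -
    have "(\<lambda>z\<in>Z. g z + l i * (F i z - a)) \<in> C'" using that by (auto simp: C'_def)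
    from p[OF this, of l] obtain z where z: "z \<in> Z"
      "0 \<le> g z + l i * (F i z - a) + (\<Sum>j\<in>I. l j * (F j z - p j))" by auto
    have "(\<Sum>j\<in>I. l j * (F j z - (p(i := a)) j)) = (\<Sum>j\<in>I. l j * (F j z - p j))"
      using insert.hyps by (intro sum.cong) auto
    then show ?thesis
      using z insert.hyps by (intro bexI[of _ z]) auto
  qed
  then show ?case by blast
qed

text \<open>Pricing the indicators of all points gives the weights, since every gamble is a linear
  combination of these indicators. The weights are not normalised; a positive total is
  enough.\<close>

lemma (in sure_loss_free_cone) dominating_weights:
  obtains p where "\<And>z. z \<in> Z \<Longrightarrow> 0 \<le> p z" "0 < (\<Sum>z\<in>Z. p z)"
    "\<And>g. g \<in> C \<Longrightarrow> 0 \<le> (\<Sum>z\<in>Z. p z * g z)"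
proof -
  obtain p where p: "\<And>g l. g \<in> C \<Longrightarrow>
      \<exists>z\<in>Z. 0 \<le> g z + (\<Sum>i\<in>Z. l i * (indicator {i} z - p i))"
    using simultaneous_extension[OF finite sure_loss_free_cone_axioms, of "\<lambda>i. indicator {i}"]
    by blast
  have eq: "(\<Sum>i\<in>Z. l i * (indicator {i} z - p i)) = l z - (\<Sum>i\<in>Z. l i * p i)" if "z \<in> Z" for l z
  proof -
    have "(\<Sum>i\<in>Z. l i * indicator {i} z) = (\<Sum>i\<in>Z. if i = z then l i else 0)"
      by (intro sum.cong) (auto simp: indicator_def)
    then show ?thesis
      using that finite by (simp add: right_diff_distrib sum_subtractf)
  qed
  \<comment> \<open>With multipliers \<open>- g\<close>, the value of \<open>g\<close> cancels at
    whichever point is obtained, leaving only the weighted sum.\<close>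
  have "0 \<le> (\<Sum>z\<in>Z. p z * g z)" if "g \<in> C" for g
    using p[OF that, of "\<lambda>z. - g z"] by (auto simp: eq sum_negf mult.commute)
  moreover have "0 \<le> p z" if "z \<in> Z" for z
  proof -
    have "(\<lambda>x\<in>Z. indicator {z} x) \<noteq> (\<lambda>x\<in>Z. 0 :: real)"
      using that by (metis indicator_simps(1) insertI1 restrict_apply' zero_neq_one)
    then have "(\<lambda>x\<in>Z. indicator {z} x) \<in> C"
      using pos by (auto simp: pos_gambles_def gambles_def)
    from calculation[OF this] have "0 \<le> (\<Sum>x\<in>Z. p x * (\<lambda>x\<in>Z. indicator {z} x) x)" .
    also have "\<dots> = (\<Sum>x\<in>Z. if x = z then p x else 0)"
      by (intro sum.cong) (auto simp: indicator_def)
    finally show ?thesis using that finite by simp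
  qed
  moreover have "0 < (\<Sum>z\<in>Z. p z)"
  proof -
    \<comment> \<open>Any constant strictly between 0 and 1 works: with all multipliers -1, the
      total weight is at least 1 - 1/2.\<close>
    have "(\<lambda>z\<in>Z. 1 / 2) \<in> C" by (rule strictly_positive_mem) simp
    from p[OF this, of "\<lambda>_. - 1"] obtain z where "z \<in> Z"
      "0 \<le> 1 / 2 + (\<Sum>i\<in>Z. - 1 * (indicator {i} z - p i))" by auto
    then show ?thesis unfolding eq[OF \<open>z \<in> Z\<close>] by (simp add: sum_negf)
  qed
  ultimately show ?thesis by (rule that[rotated 2])
qed

section \<open>Coherent marginals and slices of the product space\<close>

text \<open>If \<open>g\<close> were negative everywhere, \<open>- g\<close> would be a positive
  gamble, and adding the two would put zero into \<open>D\<close>.\<close>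

lemma coherent_imp_sure_loss_free_cone:
  assumes "finite Z" "Z \<noteq> {}" "coherent_desirable Z D"
  shows "sure_loss_free_cone Z D"
proof
  have D: "posi Z D = D" "pos_gambles Z \<subseteq> D" "(\<lambda>z\<in>Z. 0) \<notin> D"
    using assms(3) by (auto simp: coherent_desirable_def)
  show add: "(\<lambda>z\<in>Z. f z + g z) \<in> D" if "f \<in> D" "g \<in> D" for f g
    using posi_add[of f Z D g] that D(1) by simp
  show "(\<lambda>z\<in>Z. a * f z) \<in> D" if "0 < a" "f \<in> D" for a f
    using posi_scale[of f Z D a] that D(1) by simp
  show "\<exists>z\<in>Z. 0 \<le> g z" if "g \<in> D" for g
  proof (rule ccontr)
    assume neg: "\<not> ?thesis"
    obtain z where "z \<in> Z" using assms(2) by auto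
    then have "(\<lambda>z\<in>Z. - g z) \<noteq> (\<lambda>z\<in>Z. 0)"
      using neg by (metis neg_equal_0_iff_equal order_refl restrict_apply')
    then have "(\<lambda>z\<in>Z. - g z) \<in> D"
      using neg D(2) by (force simp: pos_gambles_def gambles_def)
    from add[OF that this] show False using D(3) by (simp cong: restrict_cong)
  qed
qed (use assms in \<open>auto simp: coherent_desirable_def\<close>)

text \<open>A joint point corresponds to its coordinate \<open>n\<close> together with the remaining
  ones. This allows summing over coordinate \<open>n\<close> first.\<close>

lemma sum_PiE_fiber:
  assumes "n \<in> N"
  shows "(\<Sum>z\<in>Pi\<^sub>E N X. F z) = (\<Sum>y\<in>Pi\<^sub>E (N - {n}) X. \<Sum>x\<in>X n. F (y(n := x)))"
proof -
  have "(restrict z (N - {n}))(n := z n) = z" if "z \<in> Pi\<^sub>E N X" for z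
    using that assms by (auto simp: PiE_def extensional_def fun_eq_iff)
  moreover have "restrict (y(n := x)) (N - {n}) = y" if "y \<in> Pi\<^sub>E (N - {n}) X" for y x
    using that by (auto simp: PiE_def extensional_def fun_eq_iff)
  ultimately show ?thesis
    unfolding sum.cartesian_product using assms
    by (intro sum.reindex_bij_witness[where i = "\<lambda>(y, x). y(n := x)"
          and j = "\<lambda>z. (restrict z (N - {n}), z n)"])
      (auto simp: PiE_def Pi_def extensional_def)
qed

section \<open>Decomposition of elements of the independent natural extension\<close>

locale independent_marginals =
  fixes N :: "'n set" and X :: "'n \<Rightarrow> 'x set" and D :: "'n \<Rightarrow> ('x \<Rightarrow> real) set"
  assumes finite_N: "finite N"
    and finite_X: "n \<in> N \<Longrightarrow> finite (X n)"
    and X_nonempty: "n \<in> N \<Longrightarrow> X n \<noteq> {}"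
    and coherent: "n \<in> N \<Longrightarrow> coherent_desirable (X n) (D n)"
begin

lemma marginal_cone: "n \<in> N \<Longrightarrow> sure_loss_free_cone (X n) (D n)"
  by (rule coherent_imp_sure_loss_free_cone[OF finite_X X_nonempty coherent])

lemma finite_joint: "finite (Pi\<^sub>E N X)"
  using finite_N finite_X by (simp add: finite_PiE)

lemma joint_nonempty: "Pi\<^sub>E N X \<noteq> {}"
  using X_nonempty by (simp add: PiE_eq_empty_iff)

lemma update_mem_joint:
  "n \<in> N \<Longrightarrow> y \<in> Pi\<^sub>E (N - {n}) X \<Longrightarrow> x \<in> X n \<Longrightarrow> y(n := x) \<in> Pi\<^sub>E N X"
  by (auto simp: PiE_def Pi_def extensional_def)

text \<open>Zero is inserted because \<open>D n\<close> excludes it, while a generator of the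
  irrelevance hull vanishes on all slices but one. Only values on the joint space matter, so
  \<open>h\<close> is left unrestricted.\<close>

definition conditionally_acceptable :: "('n \<Rightarrow> ('n \<Rightarrow> 'x) \<Rightarrow> real) \<Rightarrow> bool" where
  "conditionally_acceptable h \<longleftrightarrow> (\<forall>n\<in>N. \<forall>y\<in>Pi\<^sub>E (N - {n}) X.
     fix_others X n (h n) y \<in> insert (\<lambda>x\<in>X n. 0) (D n))"

lemma conditionally_acceptable_zero: "conditionally_acceptable (\<lambda>n z. 0)"
  by (simp add: conditionally_acceptable_def fix_others_def)

lemma conditionally_acceptable_add:
  assumes "conditionally_acceptable h" "conditionally_acceptable h'"
  shows "conditionally_acceptable (\<lambda>n z. h n z + h' n z)"
  unfolding conditionally_acceptable_def
proof (intro ballI)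
  fix n y assume n: "n \<in> N" and y: "y \<in> Pi\<^sub>E (N - {n}) X"
  interpret sure_loss_free_cone "X n" "D n" by (rule marginal_cone) fact
  have eq: "fix_others X n (\<lambda>z. h n z + h' n z) y
      = (\<lambda>x\<in>X n. fix_others X n (h n) y x + fix_others X n (h' n) y x)"
    by (auto simp: fix_others_def)
  have "fix_others X n (h n) y \<in> insert (\<lambda>x\<in>X n. 0) (D n)"
    "fix_others X n (h' n) y \<in> insert (\<lambda>x\<in>X n. 0) (D n)"
    using assms n y by (auto simp: conditionally_acceptable_def)
  then show "fix_others X n (\<lambda>z. h n z + h' n z) y \<in> insert (\<lambda>x\<in>X n. 0) (D n)"
    unfolding eq by (auto simp: restrict_mem add cong: restrict_cong)
qed

lemma conditionally_acceptable_scale: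
  assumes "conditionally_acceptable h" "0 < a"
  shows "conditionally_acceptable (\<lambda>n z. a * h n z)"
  unfolding conditionally_acceptable_def
proof (intro ballI)
  fix n y assume n: "n \<in> N" and y: "y \<in> Pi\<^sub>E (N - {n}) X"
  interpret sure_loss_free_cone "X n" "D n" by (rule marginal_cone) fact
  have eq: "fix_others X n (\<lambda>z. a * h n z) y = (\<lambda>x\<in>X n. a * fix_others X n (h n) y x)"
    by (auto simp: fix_others_def)
  have "fix_others X n (h n) y \<in> insert (\<lambda>x\<in>X n. 0) (D n)"
    using assms n y by (auto simp: conditionally_acceptable_def)
  then show "fix_others X n (\<lambda>z. a * h n z) y \<in> insert (\<lambda>x\<in>X n. 0) (D n)"
    unfolding eq using assms(2) by (auto simp: scale cong: restrict_cong)
qed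

text \<open>The invariant carried through both layers of positive hulls. The inequality absorbs the
  positive gambles, which dominate the zero family.\<close>

definition dominates_acceptable :: "(('n \<Rightarrow> 'x) \<Rightarrow> real) \<Rightarrow> bool" where
  "dominates_acceptable e \<longleftrightarrow>
     (\<exists>h. conditionally_acceptable h \<and> (\<forall>z\<in>Pi\<^sub>E N X. (\<Sum>n\<in>N. h n z) \<le> e z))"

lemma dominates_acceptable_add:
  assumes "dominates_acceptable e" "dominates_acceptable e'"
  shows "dominates_acceptable (\<lambda>z\<in>Pi\<^sub>E N X. e z + e' z)"
proof -
  obtain h h' where "conditionally_acceptable h" "conditionally_acceptable h'"
    "\<forall>z\<in>Pi\<^sub>E N X. (\<Sum>n\<in>N. h n z) \<le> e z" "\<forall>z\<in>Pi\<^sub>E N X. (\<Sum>n\<in>N. h' n z) \<le> e' z"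
    using assms by (auto simp: dominates_acceptable_def)
  then show ?thesis
    unfolding dominates_acceptable_def
    by (intro exI[of _ "\<lambda>n z. h n z + h' n z"])
      (auto simp: conditionally_acceptable_add sum.distrib intro!: add_mono)
qed

lemma dominates_acceptable_scale:
  assumes "0 < a" "dominates_acceptable e"
  shows "dominates_acceptable (\<lambda>z\<in>Pi\<^sub>E N X. a * e z)"
proof -
  obtain h where "conditionally_acceptable h" "\<forall>z\<in>Pi\<^sub>E N X. (\<Sum>n\<in>N. h n z) \<le> e z"
    using assms by (auto simp: dominates_acceptable_def)
  then show ?thesis
    unfolding dominates_acceptable_def using assms(1)
    by (intro exI[of _ "\<lambda>n z. a * h n z"])
      (auto simp: conditionally_acceptable_scale simp flip: sum_distrib_left)
qed

text \<open>A generator becomes the component \<open>n\<close> of a family that is zero elsewhere: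
  its slice at \<open>y\<close> is \<open>g\<close>, and all its other slices vanish.\<close>

lemma dominates_acceptable_irr:
  assumes n: "n \<in> N" and e: "e \<in> irr_gambles N X n (D n)"
  shows "dominates_acceptable e"
  using e unfolding irr_gambles_def
proof (induction rule: posi_induct)
  case (base f)
  then obtain g y where
    f: "f = (\<lambda>z\<in>Pi\<^sub>E N X. indicator {y} (restrict z (N - {n})) * g (z n))"
    and g: "g \<in> D n" and y: "y \<in> Pi\<^sub>E (N - {n}) X" by blast
  define h where "h m z = (if m = n then indicator {y} (restrict z (N - {n})) * g (z n) else 0)"
    for m z
  have "fix_others X m (h m) y' \<in> insert (\<lambda>x\<in>X m. 0) (D m)"
    if m: "m \<in> N" and y': "y' \<in> Pi\<^sub>E (N - {m}) X" for m y'
  proof (cases "m = n")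
    case True
    interpret sure_loss_free_cone "X n" "D n" by (rule marginal_cone) fact
    have "restrict (y'(n := x)) (N - {n}) = y'" for x
      using y' True by (auto simp: PiE_def extensional_def restrict_def)
    then have "fix_others X m (h m) y' = (if y' = y then restrict g (X n) else (\<lambda>x\<in>X n. 0))"
      using True by (auto simp: fix_others_def h_def)
    then show ?thesis using True g restrict_mem by auto
  qed (simp add: fix_others_def h_def)
  moreover have "(\<Sum>m\<in>N. h m z) = indicator {y} (restrict z (N - {n})) * g (z n)" for z
    using n finite_N by (simp add: h_def)
  ultimately show ?case
    unfolding dominates_acceptable_def conditionally_acceptable_def f
    by (intro exI[of _ h]) auto
qed (simp_all only: dominates_acceptable_add dominates_acceptable_scale)

lemma dominates_acceptable_indep_nat_ext:
  assumes "e \<in> indep_nat_ext N X D"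
  shows "dominates_acceptable e"
  using assms unfolding indep_nat_ext_def
proof (induction rule: posi_induct)
  case (base f)
  then show ?case
  proof
    assume "f \<in> pos_gambles (Pi\<^sub>E N X)"
    then show ?thesis
      unfolding dominates_acceptable_def pos_gambles_def
      by (intro exI[of _ "\<lambda>n z. 0"]) (auto simp: conditionally_acceptable_zero)
  qed (auto intro: dominates_acceptable_irr)
qed (simp_all only: dominates_acceptable_add dominates_acceptable_scale)

section \<open>The independent natural extension avoids sure loss\<close>

lemma no_sure_loss_joint:
  assumes "dominates_acceptable e"
  shows "\<exists>z\<in>Pi\<^sub>E N X. 0 \<le> e z"
proof (rule ccontr)
  assume neg: "\<not> ?thesis"
  obtain h where h: "conditionally_acceptable h" "\<And>z. z \<in> Pi\<^sub>E N X \<Longrightarrow> (\<Sum>n\<in>N. h n z) \<le> e z"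
    using assms by (auto simp: dominates_acceptable_def)
  have "\<exists>p. (\<forall>x\<in>X n. 0 \<le> p x) \<and> 0 < (\<Sum>x\<in>X n. p x) \<and> (\<forall>g\<in>D n. 0 \<le> (\<Sum>x\<in>X n. p x * g x))"
    if "n \<in> N" for n
    using sure_loss_free_cone.dominating_weights[OF marginal_cone[OF that]] by metis
  then obtain p where p_nonneg: "\<And>n x. n \<in> N \<Longrightarrow> x \<in> X n \<Longrightarrow> 0 \<le> p n x"
    and p_sum: "\<And>n. n \<in> N \<Longrightarrow> 0 < (\<Sum>x\<in>X n. p n x)"
    and p_D: "\<And>n g. n \<in> N \<Longrightarrow> g \<in> D n \<Longrightarrow> 0 \<le> (\<Sum>x\<in>X n. p n x * g x)"
    by metis
  \<comment> \<open>The product weights make the coordinates independent; their total is the product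
    of the marginal totals, hence positive.\<close>
  define w where "w z = (\<Prod>n\<in>N. p n (z n))" for z
  have w_nonneg: "0 \<le> w z" if "z \<in> Pi\<^sub>E N X" for z
    unfolding w_def using that p_nonneg by (intro prod_nonneg) auto
  have "0 < (\<Prod>n\<in>N. \<Sum>x\<in>X n. p n x)"
    by (rule prod_pos) (use p_sum in auto)
  also have "\<dots> = (\<Sum>z\<in>Pi\<^sub>E N X. w z)"
    unfolding w_def using finite_N finite_X by (rule prod_sum_PiE)
  finally have w_sum: "0 < (\<Sum>z\<in>Pi\<^sub>E N X. w z)" .
  have "0 \<le> (\<Sum>z\<in>Pi\<^sub>E N X. w z * h n z)" if n: "n \<in> N" for n
  proof -
    have "0 \<le> (\<Sum>x\<in>X n. w (y(n := x)) * h n (y(n := x)))" if y: "y \<in> Pi\<^sub>E (N - {n}) X" for y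
    proof -
      \<comment> \<open>The joint weight of the coordinates other than \<open>n\<close> is constant
        along a slice and factors out, leaving a marginal weighted sum.\<close>
      define c where "c = (\<Prod>m\<in>N - {n}. p m (y m))"
      have "w (y(n := x)) = c * p n x" for x
        unfolding w_def c_def using n finite_N by (simp add: prod.remove[of N n])
      then have "(\<Sum>x\<in>X n. w (y(n := x)) * h n (y(n := x)))
          = c * (\<Sum>x\<in>X n. p n x * fix_others X n (h n) y x)"
        by (simp add: fix_others_def sum_distrib_left mult.assoc)
      moreover have "0 \<le> c"
        unfolding c_def using y p_nonneg by (intro prod_nonneg) auto
      moreover have "0 \<le> (\<Sum>x\<in>X n. p n x * fix_others X n (h n) y x)"
      proof (cases "fix_others X n (h n) y \<in> D n")
        case False
        then have "fix_others X n (h n) y = (\<lambda>x\<in>X n. 0)"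
          using h(1) n y by (auto simp: conditionally_acceptable_def)
        then show ?thesis by simp
      qed (rule p_D[OF n])
      ultimately show ?thesis by simp
    qed
    then show ?thesis unfolding sum_PiE_fiber[OF n] by (rule sum_nonneg)
  qed
  then have "0 \<le> (\<Sum>n\<in>N. \<Sum>z\<in>Pi\<^sub>E N X. w z * h n z)" by (rule sum_nonneg)
  also have "\<dots> = (\<Sum>z\<in>Pi\<^sub>E N X. w z * (\<Sum>n\<in>N. h n z))"
    by (subst sum.swap) (simp add: sum_distrib_left)
  also have "\<dots> \<le> (\<Sum>z\<in>Pi\<^sub>E N X. w z * e z)"
    using h(2) w_nonneg by (intro sum_mono mult_left_mono)
  finally have "0 \<le> (\<Sum>z\<in>Pi\<^sub>E N X. w z * e z)" .
  moreover have "(\<Sum>z\<in>Pi\<^sub>E N X. w z * e z) < 0"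
  proof -
    \<comment> \<open>Single weights may vanish, so strictness comes from one point of positive
      weight.\<close>
    obtain z where z: "z \<in> Pi\<^sub>E N X" "0 < w z"
      using w_sum by (meson not_le sum_nonpos)
    then have "w z * e z < 0" using neg by (simp add: mult_pos_neg not_le)
    moreover have "(\<Sum>z\<in>Pi\<^sub>E N X - {z}. w z * e z) \<le> 0"
      using neg w_nonneg by (intro sum_nonpos mult_nonneg_nonpos) auto
    ultimately show ?thesis
      using z finite_joint by (simp add: sum.remove[of _ z])
  qed
  ultimately show False by simp
qed

lemma indep_nat_ext_cone: "sure_loss_free_cone (Pi\<^sub>E N X) (indep_nat_ext N X D)"
proof
  show "indep_nat_ext N X D \<subseteq> gambles (Pi\<^sub>E N X)"
    unfolding indep_nat_ext_def by (rule posi_subset_gambles)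
  show "pos_gambles (Pi\<^sub>E N X) \<subseteq> indep_nat_ext N X D"
    unfolding indep_nat_ext_def by (auto intro!: posi_superset simp: pos_gambles_def)
qed (auto simp: indep_nat_ext_def posi_add posi_scale finite_joint joint_nonempty
      intro: no_sure_loss_joint dominates_acceptable_indep_nat_ext[unfolded indep_nat_ext_def])

lemma indicator_times_mem_indep_nat_ext:
  assumes "n \<in> N" "y \<in> Pi\<^sub>E (N - {n}) X" "g \<in> D n"
  shows "(\<lambda>z\<in>Pi\<^sub>E N X. indicator {y} (restrict z (N - {n})) * g (z n)) \<in> indep_nat_ext N X D"
proof -
  have "(\<lambda>z\<in>Pi\<^sub>E N X. indicator {y} (restrict z (N - {n})) * g (z n)) \<in> irr_gambles N X n (D n)"
    unfolding irr_gambles_def using assms(2,3)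
    by (intro posi_superset) (blast, simp add: gambles_def)
  then show ?thesis
    unfolding indep_nat_ext_def using assms(1)
    by (intro posi_superset) (blast, simp add: gambles_def)
qed

lemma fix_others_apply:
  "z \<in> Pi\<^sub>E N X \<Longrightarrow> n \<in> N \<Longrightarrow> fix_others X n h (restrict z (N - {n})) (z n) = h z"
proof -
  assume z: "z \<in> Pi\<^sub>E N X" "n \<in> N"
  have "(restrict z (N - {n}))(n := z n) = z"
    using z by (auto simp: PiE_def extensional_def fun_eq_iff)
  then show ?thesis using z by (auto simp: fix_others_def PiE_mem)
qed

section \<open>Comparison of the two lower previsions\<close>

definition penalized :: "('n \<Rightarrow> ('n \<Rightarrow> 'x) \<Rightarrow> real) \<Rightarrow> (('n \<Rightarrow> 'x) \<Rightarrow> real) \<Rightarrow> ('n \<Rightarrow> 'x) \<Rightarrow> real" where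
  "penalized h f z = f z - (\<Sum>n\<in>N. h n z
     - lower_prevision (X n) (D n) (fix_others X n (h n) (restrict z (N - {n}))))"

lemma indep_nat_ext_prevision_eq:
  assumes "\<And>n g. n \<in> N \<Longrightarrow> g \<in> gambles (X n) \<Longrightarrow> P n g = lower_prevision (X n) (D n) g"
  shows "indep_nat_ext_prevision N X P f =
    (SUP h \<in> N \<rightarrow>\<^sub>E gambles (Pi\<^sub>E N X). MIN z \<in> Pi\<^sub>E N X. penalized h f z)"
proof -
  have "P n (fix_others X n h y) = lower_prevision (X n) (D n) (fix_others X n h y)"
    if "n \<in> N" for n h y
    using that by (intro assms) (auto simp: fix_others_def gambles_def)
  then show ?thesis
    unfolding indep_nat_ext_prevision_def penalized_def by (simp cong: sum.cong)
qed

text \<open>Lowering each local prevision by \<eta> makes every centred slice of \<open>h n\<close>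
  desirable. Pasting the slices together with indicators gives an element of the extension that
  \<open>f\<close> minus the minimum dominates up to \<epsilon>.\<close>

lemma Min_penalized_le:
  "(MIN z \<in> Pi\<^sub>E N X. penalized h f z) \<le> lower_prevision (Pi\<^sub>E N X) (indep_nat_ext N X D) f"
proof (rule field_le_epsilon)
  fix \<epsilon> :: real assume "0 < \<epsilon>"
  define Y where "Y n = Pi\<^sub>E (N - {n}) X" for n
  define \<mu> where "\<mu> = (MIN z \<in> Pi\<^sub>E N X. penalized h f z)"
  \<comment> \<open>One share of \<epsilon> for each index, and one for the constant gamble that
    starts the sum in \<open>add_sum_mem\<close>.\<close>
  define \<eta> where "\<eta> = \<epsilon> / (card N + 1)"
  define L where "L n y = lower_prevision (X n) (D n) (fix_others X n (h n) y)" for n y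
  define g where "g n y = (\<lambda>x\<in>X n. fix_others X n (h n) y x - (L n y - \<eta>))" for n y
  interpret sure_loss_free_cone "Pi\<^sub>E N X" "indep_nat_ext N X D" by (rule indep_nat_ext_cone)
  have "0 < \<eta>" using \<open>0 < \<epsilon>\<close> by (simp add: \<eta>_def)
  have finite_Y: "finite (Y n)" for n
    unfolding Y_def using finite_N finite_X by (intro finite_PiE) auto
  have "g n y \<in> D n" if "n \<in> N" for n y
    unfolding g_def using \<open>0 < \<eta>\<close>
    by (intro sure_loss_free_cone.less_lower_prevision_mem[OF marginal_cone[OF that]]) (simp add: L_def)
  then have "(\<lambda>z\<in>Pi\<^sub>E N X. case i of (n, y) \<Rightarrow> indicator {y} (restrict z (N - {n})) * g n y (z n))
      \<in> indep_nat_ext N X D" if "i \<in> Sigma N Y" for i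
    using that by (auto simp: Y_def split: prod.splits intro!: indicator_times_mem_indep_nat_ext)
  moreover have "(\<lambda>z\<in>Pi\<^sub>E N X. \<eta>) \<in> indep_nat_ext N X D"
    using \<open>0 < \<eta>\<close> by (intro strictly_positive_mem)
  ultimately have G: "(\<lambda>z\<in>Pi\<^sub>E N X. (\<lambda>z\<in>Pi\<^sub>E N X. \<eta>) z + (\<Sum>i\<in>Sigma N Y.
      case i of (n, y) \<Rightarrow> indicator {y} (restrict z (N - {n})) * g n y (z n))) \<in> indep_nat_ext N X D"
    by (intro add_sum_mem finite_SigmaI finite_N finite_Y)
  have "(\<lambda>z\<in>Pi\<^sub>E N X. f z - (\<mu> - \<epsilon>)) \<in> indep_nat_ext N X D"
  proof (rule mono[OF G])
    fix z assume z: "z \<in> Pi\<^sub>E N X"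
    have "(\<Sum>i\<in>Sigma N Y. case i of (n, y) \<Rightarrow> indicator {y} (restrict z (N - {n})) * g n y (z n))
        = (\<Sum>n\<in>N. \<Sum>y\<in>Y n. indicator {y} (restrict z (N - {n})) * g n y (z n))"
      by (intro sum.Sigma[symmetric] ballI finite_N finite_Y)
    also have "\<dots> = (\<Sum>n\<in>N. h n z - L n (restrict z (N - {n})) + \<eta>)"
    proof (rule sum.cong[OF refl])
      fix n assume n: "n \<in> N"
      have "(\<Sum>y\<in>Y n. indicator {y} (restrict z (N - {n})) * g n y (z n))
          = (\<Sum>y\<in>Y n. if y = restrict z (N - {n}) then g n y (z n) else 0)"
        by (intro sum.cong) (auto simp: indicator_def)
      \<comment> \<open>At \<open>z\<close>, only the slice through \<open>z\<close>
        contributes.\<close>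
      also have "\<dots> = g n (restrict z (N - {n})) (z n)"
        using z finite_Y by (auto simp: Y_def)
      also have "\<dots> = h n z - L n (restrict z (N - {n})) + \<eta>"
        using z n by (auto simp: g_def fix_others_apply)
      finally show "(\<Sum>y\<in>Y n. indicator {y} (restrict z (N - {n})) * g n y (z n))
          = h n z - L n (restrict z (N - {n})) + \<eta>" .
    qed
    also have "\<dots> = f z - penalized h f z + card N * \<eta>"
      by (simp add: penalized_def L_def sum.distrib)
    finally have "(\<Sum>i\<in>Sigma N Y. case i of (n, y) \<Rightarrow> indicator {y} (restrict z (N - {n})) * g n y (z n))
        = f z - penalized h f z + card N * \<eta>" .
    moreover have "\<mu> \<le> penalized h f z"
      unfolding \<mu>_def using z finite_joint by simp
    moreover have "\<eta> + card N * \<eta> = \<epsilon>"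
    proof -
      have "\<eta> * (card N + 1) = \<epsilon>" unfolding \<eta>_def by simp
      then show ?thesis by (simp add: algebra_simps)
    qed
    ultimately show "(\<lambda>z\<in>Pi\<^sub>E N X. (\<lambda>z\<in>Pi\<^sub>E N X. \<eta>) z + (\<Sum>i\<in>Sigma N Y.
        case i of (n, y) \<Rightarrow> indicator {y} (restrict z (N - {n})) * g n y (z n))) z \<le> f z - (\<mu> - \<epsilon>)"
      using z by simp
  qed
  from le_lower_prevision[OF this]
  show "(MIN z \<in> Pi\<^sub>E N X. penalized h f z)
      \<le> lower_prevision (Pi\<^sub>E N X) (indep_nat_ext N X D) f + \<epsilon>"
    by (simp add: \<mu>_def)
qed

text \<open>The family dominated by \<open>f - \<mu>\<close> serves as \<open>h\<close>: its slices
  are zero or desirable, so subtracting their non-negative local previsions only lowers the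
  sum.\<close>

lemma ex_Min_penalized_ge:
  assumes "(\<lambda>z\<in>Pi\<^sub>E N X. f z - \<mu>) \<in> indep_nat_ext N X D"
  shows "\<exists>h\<in>N \<rightarrow>\<^sub>E gambles (Pi\<^sub>E N X). \<mu> \<le> (MIN z \<in> Pi\<^sub>E N X. penalized h f z)"
proof -
  obtain h where h: "conditionally_acceptable h"
    "\<And>z. z \<in> Pi\<^sub>E N X \<Longrightarrow> (\<Sum>n\<in>N. h n z) \<le> f z - \<mu>"
    using dominates_acceptable_indep_nat_ext[OF assms] by (auto simp: dominates_acceptable_def)
  \<comment> \<open>Restriction turns the family into gambles, as the supremum requires, without
    changing slices inside the joint space.\<close>
  define h' where "h' = (\<lambda>n\<in>N. restrict (h n) (Pi\<^sub>E N X))"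
  have "\<mu> \<le> penalized h' f z" if z: "z \<in> Pi\<^sub>E N X" for z
  proof -
    have "0 \<le> lower_prevision (X n) (D n) (fix_others X n (h' n) (restrict z (N - {n})))"
      if n: "n \<in> N" for n
    proof (rule sure_loss_free_cone.lower_prevision_nonneg[OF marginal_cone[OF n]])
      have y: "restrict z (N - {n}) \<in> Pi\<^sub>E (N - {n}) X" using z by auto
      then have "fix_others X n (h' n) (restrict z (N - {n}))
          = fix_others X n (h n) (restrict z (N - {n}))"
        using n update_mem_joint[OF n y] by (auto simp: fix_others_def h'_def)
      moreover have "fix_others X n (h n) (restrict z (N - {n})) \<in> insert (\<lambda>x\<in>X n. 0) (D n)"
        using h(1) n y by (auto simp: conditionally_acceptable_def)
      ultimately show "fix_others X n (h' n) (restrict z (N - {n})) \<in> D n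
          \<or> (\<forall>x\<in>X n. fix_others X n (h' n) (restrict z (N - {n})) x = 0)"
        by auto
    qed
    then have "(\<Sum>n\<in>N. h' n z
        - lower_prevision (X n) (D n) (fix_others X n (h' n) (restrict z (N - {n}))))
        \<le> (\<Sum>n\<in>N. h n z)"
      using z by (intro sum_mono) (simp add: h'_def)
    then show ?thesis using h(2)[OF z] by (simp add: penalized_def)
  qed
  then have "\<mu> \<le> (MIN z \<in> Pi\<^sub>E N X. penalized h' f z)"
    using finite_joint joint_nonempty by simp
  moreover have "h' \<in> N \<rightarrow>\<^sub>E gambles (Pi\<^sub>E N X)"
    by (auto simp: h'_def gambles_def)
  ultimately show ?thesis by blast
qed

end

theorem theorem21:
  fixes N :: "'n set"
    and X :: "'n \<Rightarrow> 'x set"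
    and D :: "'n \<Rightarrow> ('x \<Rightarrow> real) set"
    and P :: "'n \<Rightarrow> ('x \<Rightarrow> real) \<Rightarrow> real"
  assumes "finite N" and "N \<noteq> {}"
    and "\<And>n. n \<in> N \<Longrightarrow> finite (X n)"
    and "\<And>n. n \<in> N \<Longrightarrow> X n \<noteq> {}"
    and "\<And>n. n \<in> N \<Longrightarrow> coherent_desirable (X n) (D n)"
    and "\<And>n g. n \<in> N \<Longrightarrow> g \<in> gambles (X n) \<Longrightarrow> P n g = lower_prevision (X n) (D n) g"
  shows "\<forall>f \<in> gambles (Pi\<^sub>E N X).
    indep_nat_ext_prevision N X P f = lower_prevision (Pi\<^sub>E N X) (indep_nat_ext N X D) f"
proof
  fix f
  interpret independent_marginals N X D
    by (rule independent_marginals.intro) (use assms in auto)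
  let ?H = "N \<rightarrow>\<^sub>E gambles (Pi\<^sub>E N X)"
  let ?m = "\<lambda>h. MIN z \<in> Pi\<^sub>E N X. penalized h f z"
  have H: "?H \<noteq> {}" by (auto simp: PiE_eq_empty_iff gambles_def)
  \<comment> \<open>The bound of \<open>Min_penalized_le\<close> is uniform in \<open>h\<close>, so
    the real \<open>SUP\<close> is a genuine supremum.\<close>
  have bdd: "bdd_above (?m ` ?H)"
    using Min_penalized_le by (intro bdd_aboveI2)
  have "(SUP h \<in> ?H. ?m h) = lower_prevision (Pi\<^sub>E N X) (indep_nat_ext N X D) f"
  proof (rule antisym)
    show "(SUP h \<in> ?H. ?m h) \<le> lower_prevision (Pi\<^sub>E N X) (indep_nat_ext N X D) f"
      using H Min_penalized_le by (intro cSUP_least)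
    show "lower_prevision (Pi\<^sub>E N X) (indep_nat_ext N X D) f \<le> (SUP h \<in> ?H. ?m h)"
    proof (rule sure_loss_free_cone.lower_prevision_le[OF indep_nat_ext_cone])
      fix \<mu> assume "(\<lambda>z\<in>Pi\<^sub>E N X. f z - \<mu>) \<in> indep_nat_ext N X D"
      then obtain h where "h \<in> ?H" "\<mu> \<le> ?m h" using ex_Min_penalized_ge by blast
      then show "\<mu> \<le> (SUP h \<in> ?H. ?m h)" by (rule cSUP_upper2[OF bdd])
    qed
  qed
  then show "indep_nat_ext_prevision N X P f = lower_prevision (Pi\<^sub>E N X) (indep_nat_ext N X D) f"
    using indep_nat_ext_prevision_eq[of P f] assms(6) by simp
qed

end
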